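(* If $A$ is a coherent $PF$-quantale, then $\mathrm{Min}(A)=\mathrm{Max}(\mathrm{Vir}(A))$ (equality of subsets of $A$).
   Context: A quantale is a complete lattice $(A,\vee,\wedge,0,1)$ with an associative multiplication distributing over arbitrary joins in each variable. All quantales are assumed commutative and integral ($1$ is the multiplicative unit). $K(A)$ is the set of compact elements. $A$ is algebraic if every element is a join of compact elements; $A$ is coherent if it is algebraic, $1\in K(A)$ and $K(A)$ is closed under multiplication. $a^{\perp}=\bigvee\{x\in A: ax=0\}$. An element $p<1$ is $m$-prime if $ab\le p$ implies $a\le p$ or $b\le p$; $\mathrm{Min}(A)$ is the set of minimal $m$-prime elements. An element $a$ is pure if for all $c\in K(A)$, $c\le a$ implies $a\vee c^{\perp}=1$; the set $\mathrm{Vir}(A)$ of pure elements is a frame with the joins and finite meets of $A$. $\mathrm{Max}(\mathrm{Vir}(A))$ is the set of maximal elements of $\mathrm{Vir}(A)\setminus\{1\}$. $A$ is a $PF$-quantale if $c^{\perp}$ is pure for every $c\in K(A)$. *)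

theory Defs
  imports Main
begin

class quantale = complete_lattice + semigroup_mult +
  assumes mult_Sup_right: "a * Sup B = (SUP b\<in>B. a * b)"
    and mult_Sup_left: "Sup B * a = (SUP b\<in>B. b * a)"

text \<open>The least element 0 is written \<open>bot\<close>; integrality says that the greatest
  element \<open>top\<close> is the multiplicative unit \<open>1\<close>.\<close>

class comm_integral_quantale = quantale + comm_monoid_mult +
  assumes one_eq_top: "1 = top"

definition K :: "'a::comm_integral_quantale set" where
  "K = {c. \<forall>S. c \<le> Sup S \<longrightarrow> (\<exists>T. finite T \<and> T \<subseteq> S \<and> c \<le> Sup T)}"

text \<open>The \<open>itself\<close> argument is there only to name the quantale \<open>'a\<close> that the property is about.\<close>

definition algebraic :: "'a::comm_integral_quantale itself \<Rightarrow> bool" where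
  "algebraic A \<longleftrightarrow> (\<forall>a::'a. \<exists>S. S \<subseteq> K \<and> a = Sup S)"

definition coherent :: "'a::comm_integral_quantale itself \<Rightarrow> bool" where
  "coherent A \<longleftrightarrow> algebraic A \<and> (1::'a) \<in> K \<and> (\<forall>c\<in>K. \<forall>d\<in>K. (c::'a) * d \<in> K)"

definition perp :: "'a::comm_integral_quantale \<Rightarrow> 'a" where
  "perp a = Sup {x. a * x = bot}"

definition m_prime :: "'a::comm_integral_quantale \<Rightarrow> bool" where
  "m_prime p \<longleftrightarrow> p < 1 \<and> (\<forall>a b. a * b \<le> p \<longrightarrow> a \<le> p \<or> b \<le> p)"

definition Min_primes :: "'a::comm_integral_quantale set" where
  "Min_primes = {p. m_prime p \<and> (\<forall>q. m_prime q \<and> q \<le> p \<longrightarrow> q = p)}"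

definition pure :: "'a::comm_integral_quantale \<Rightarrow> bool" where
  "pure a \<longleftrightarrow> (\<forall>c\<in>K. c \<le> a \<longrightarrow> sup a (perp c) = 1)"

definition Vir :: "'a::comm_integral_quantale set" where
  "Vir = {a. pure a}"

definition Max_Vir :: "'a::comm_integral_quantale set" where
  "Max_Vir = {p \<in> Vir - {1}. \<forall>q \<in> Vir - {1}. p \<le> q \<longrightarrow> q = p}"

definition PF_quantale :: "'a::comm_integral_quantale itself \<Rightarrow> bool" where
  "PF_quantale A \<longleftrightarrow> (\<forall>c\<in>(K::'a set). pure (perp c))"

end

theory Submission
  imports Defs
begin

text \<open>For an \<open>m\<close>-prime \<open>p\<close> let \<open>O(p)\<close> (\<open>prime_part p\<close> below) be the join of the compact \<open>c\<close> with \<open>perp c \<le> p\<close> false.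
  These \<open>c\<close> form an ideal, so they are exactly the compact elements below \<open>O(p)\<close>, and
  \<open>O(p) \<le> p\<close> because \<open>c * perp c = 0\<close>. In a PF-quantale \<open>c * d = 0\<close> forces
  \<open>perp c \<squnion> perp d = 1\<close> for compact \<open>c\<close>, \<open>d\<close>; this makes \<open>O(p)\<close> both \<open>m\<close>-prime and pure.
  Hence a minimal prime equals its \<open>O(p)\<close>, so it is pure. Conversely, a proper pure element lies
  below some \<open>m\<close>-prime \<open>m\<close>, and then below \<open>O(m)\<close>; so if it is maximal, it equals \<open>O(m)\<close>.
  Since \<open>a \<squnion> perp c = 1\<close> for compact \<open>c\<close> below a pure \<open>a\<close>, an \<open>m\<close>-prime \<open>q\<close> cannot lie
  strictly below a proper pure \<open>a\<close>: a compact \<open>c \<le> a\<close> not below \<open>q\<close> would have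
  \<open>perp c \<le> q \<le> a\<close>. This gives minimality and maximality.\<close>

section \<open>Order properties of the multiplication\<close>

context comm_integral_quantale
begin

lemma le_one: "a \<le> 1"
  by (simp add: one_eq_top)

lemma mult_sup_distrib_left: "a * sup b c = sup (a * b) (a * c)"
  using mult_Sup_right[of a "{b, c}"] by simp

lemma mult_sup_distrib_right: "sup b c * a = sup (b * a) (c * a)"
  using mult_Sup_left[of "{b, c}" a] by simp

lemma mult_mono_right: "b \<le> c \<Longrightarrow> a * b \<le> a * c"
  by (metis mult_sup_distrib_left sup.absorb_iff2 sup.cobounded1)

lemma mult_le_left: "a * b \<le> a"
  using mult_mono_right[of b 1 a] le_one[of b] by simp

lemma mult_le_right: "a * b \<le> b"
  using mult_le_left[of b a] by (simp add: mult.commute)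

end

section \<open>Annihilators and compact elements\<close>

lemma mult_perp: "c * perp c = bot"
  unfolding perp_def mult_Sup_right by (auto intro: antisym SUP_least)

lemma le_perp_iff: "x \<le> perp c \<longleftrightarrow> c * x = bot"
proof
  assume "x \<le> perp c"
  then have "c * x \<le> c * perp c" by (rule mult_mono_right)
  then show "c * x = bot" by (simp add: mult_perp bot_unique)
next
  assume "c * x = bot"
  then show "x \<le> perp c" unfolding perp_def by (intro Sup_upper) simp
qed

lemma compactD:
  assumes "c \<in> K" "c \<le> Sup S"
  obtains T where "finite T" "T \<subseteq> S" "c \<le> Sup T"
  using assms unfolding K_def by auto

lemma bot_compact: "bot \<in> K"
  unfolding K_def by auto

lemma sup_compact:
  assumes "c \<in> K" "d \<in> K"
  shows "sup c d \<in> K"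
proof -
  have "\<exists>T. finite T \<and> T \<subseteq> S \<and> sup c d \<le> Sup T" if "sup c d \<le> Sup S" for S
  proof -
    from that have "c \<le> Sup S" and "d \<le> Sup S" by simp_all
    obtain T where T: "finite T" "T \<subseteq> S" "c \<le> Sup T"
      using \<open>c \<le> Sup S\<close> by (rule compactD[OF assms(1)])
    obtain U where U: "finite U" "U \<subseteq> S" "d \<le> Sup U"
      using \<open>d \<le> Sup S\<close> by (rule compactD[OF assms(2)])
    from T U show ?thesis
      by (intro exI[of _ "T \<union> U"]) (auto simp: Sup_union_distrib le_supI1 le_supI2)
  qed
  then show ?thesis unfolding K_def by blast
qed

lemma m_prime_mult: "m_prime p \<Longrightarrow> a * b \<le> p \<Longrightarrow> a \<le> p \<or> b \<le> p"
  unfolding m_prime_def by blast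

text \<open>Zorn's lemma on the proper elements above \<open>a\<close> yields a maximal one: as
  \<open>1\<close> is compact, the join of a nonempty chain of proper elements is again proper. A
  maximal proper element is \<open>m\<close>-prime.\<close>

lemma ex_m_prime_above:
  fixes a :: "'a::comm_integral_quantale"
  assumes one: "(1::'a) \<in> K" and "a \<noteq> 1"
  obtains m where "m_prime m" "a \<le> m"
proof -
  define A where "A = {x. a \<le> x \<and> x \<noteq> 1}"
  have "\<exists>m\<in>A. \<forall>x\<in>A. m \<le> x \<longrightarrow> x = m"
  proof (rule predicate_Zorn)
    show "partial_order_on A (relation_of (\<le>) A)"
      by (rule partial_order_on_relation_ofI) auto
  next
    fix C assume "C \<in> Chains (relation_of (\<le>) A)"
    then have C: "C \<subseteq> A" and chain: "x \<le> y \<or> y \<le> x" if "x \<in> C" "y \<in> C" for x y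
      using that unfolding Chains_def relation_of_def by auto
    show "\<exists>u\<in>A. \<forall>x\<in>C. x \<le> u"
    proof (cases "C = {}")
      case True
      then show ?thesis using \<open>a \<noteq> 1\<close> unfolding A_def by auto
    next
      case False
      then obtain x where x: "x \<in> C" by blast
      have "Sup C \<noteq> 1"
      proof
        assume "Sup C = 1"
        then obtain T where T: "finite T" "T \<subseteq> C" "1 \<le> Sup T"
          using compactD[OF one, of C] by auto
        \<comment> \<open>\<open>x\<close> is inserted because \<open>T\<close> may be empty; a
          maximal element of a finite chain bounds it.\<close>
        obtain m where m: "m \<in> insert x T" "\<forall>y\<in>insert x T. m \<le> y \<longrightarrow> m = y"
          using finite_has_maximal[of "insert x T"] T by auto
        have "y \<le> m" if "y \<in> T" for y
          using chain[of y m] that m T x by auto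
        then have "1 \<le> m" using T(3) Sup_least[of T m] by (blast intro: order_trans)
        then have "m = 1" by (simp add: antisym le_one)
        then show False using m T C x unfolding A_def by auto
      qed
      moreover have "a \<le> Sup C" using C x unfolding A_def by (auto intro: Sup_upper2)
      ultimately show ?thesis unfolding A_def by (auto intro: Sup_upper)
    qed
  qed
  then obtain m where m: "a \<le> m" "m \<noteq> 1" and max: "\<And>x. m \<le> x \<Longrightarrow> x \<noteq> 1 \<Longrightarrow> x = m"
    unfolding A_def by (auto intro: order_trans)
  have "x \<le> m \<or> y \<le> m" if "x * y \<le> m" for x y
  proof (rule ccontr)
    assume "\<not> (x \<le> m \<or> y \<le> m)"
    then have "sup m x \<noteq> m" "sup m y \<noteq> m" by (simp_all add: sup.absorb_iff1)
    then have "sup m x = 1" "sup m y = 1"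
      using max[of "sup m x"] max[of "sup m y"] by (simp_all only: sup_ge1) blast+
    \<comment> \<open>Of the four products in the expansion, three have the factor \<open>m\<close>
      and the last is \<open>x * y\<close>.\<close>
    then have "1 = sup m x * sup m y" by simp
    also have "\<dots> \<le> m"
      using that by (simp add: mult_sup_distrib_left mult_sup_distrib_right mult_le_left mult_le_right)
    finally show False using m(2) by (simp add: antisym le_one)
  qed
  then have "m_prime m" unfolding m_prime_def using m(2) by (auto simp: less_le le_one)
  with m(1) show thesis by (rule that[rotated])
qed

section \<open>The analogue of the kernel of localisation at a prime ideal\<close>

definition prime_part :: "'a::comm_integral_quantale \<Rightarrow> 'a" where
  "prime_part p = Sup {c \<in> K. \<not> perp c \<le> p}"

lemma prime_part_le:
  assumes "m_prime p"
  shows "prime_part p \<le> p"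
proof -
  have "c \<le> p" if "\<not> perp c \<le> p" for c
    using m_prime_mult[OF assms, of c "perp c"] that by (simp add: mult_perp)
  then show ?thesis unfolding prime_part_def by (auto intro: Sup_least)
qed

text \<open>Compactness puts \<open>c\<close> below a finite join of generators. Such a join is
  again a generator, by primeness of \<open>p\<close>. As \<open>perp\<close> reverses the order,
  the claim passes to \<open>c\<close>.\<close>

lemma compact_le_prime_part_iff:
  assumes p: "m_prime p" and c: "c \<in> K"
  shows "c \<le> prime_part p \<longleftrightarrow> \<not> perp c \<le> p"
proof
  assume "c \<le> prime_part p"
  then obtain T where T: "finite T" "T \<subseteq> {c \<in> K. \<not> perp c \<le> p}" "c \<le> Sup T"
    unfolding prime_part_def by (rule compactD[OF c])
  have "Sup T \<in> K \<and> \<not> perp (Sup T) \<le> p" using T(1,2)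
  proof (induction T)
    case empty
    have "perp bot = (1::'a)"
      by (intro antisym le_one) (simp add: le_perp_iff)
    then show ?case using p by (auto simp: bot_compact m_prime_def)
  next
    case (insert x F)
    \<comment> \<open>\<open>?u\<close> annihilates \<open>x\<close> and \<open>Sup F\<close>, yet
      is not below \<open>p\<close>, since neither factor is.\<close>
    let ?u = "perp x * perp (Sup F)"
    have "x * ?u = bot" "Sup F * ?u = bot"
      by (simp_all only: le_perp_iff[symmetric] mult_le_left mult_le_right)
    then have "?u \<le> perp (sup x (Sup F))"
      by (simp add: le_perp_iff mult_sup_distrib_right)
    then show ?case using insert m_prime_mult[OF p, of "perp x" "perp (Sup F)"]
      by (auto intro: sup_compact order_trans)
  qed
  moreover have "perp (Sup T) \<le> perp c"
  proof -
    have "perp (Sup T) * c \<le> perp (Sup T) * Sup T" by (rule mult_mono_right[OF T(3)])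
    also have "\<dots> = bot" by (simp only: mult.commute[of "perp (Sup T)"] mult_perp)
    finally show ?thesis by (simp add: le_perp_iff bot_unique mult.commute)
  qed
  ultimately show "\<not> perp c \<le> p" by (auto intro: order_trans)
next
  assume "\<not> perp c \<le> p"
  then show "c \<le> prime_part p" unfolding prime_part_def using c by (auto intro: Sup_upper)
qed

text \<open>The contrapositive supplies witnesses: if \<open>a\<close> is not below
  \<open>b\<close>, some compact element below \<open>a\<close> is not below
  \<open>b\<close>.\<close>

lemma algebraic_leI:
  fixes a b :: "'a::comm_integral_quantale"
  assumes "algebraic TYPE('a)" "\<And>c. c \<in> K \<Longrightarrow> c \<le> a \<Longrightarrow> c \<le> b"
  shows "a \<le> b"
proof -
  obtain S where "S \<subseteq> K" "a = Sup S" using assms(1) unfolding algebraic_def by blast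
  then show ?thesis using assms(2) by (auto intro!: Sup_least intro: Sup_upper)
qed

text \<open>\<open>d\<close> is a compact element below \<open>perp c\<close>, so this is purity of
  \<open>perp c\<close> at \<open>d\<close>.\<close>

lemma PF_sup_perp:
  fixes c d :: "'a::comm_integral_quantale"
  assumes "PF_quantale TYPE('a)" "c \<in> K" "d \<in> K" "c * d = bot"
  shows "sup (perp c) (perp d) = 1"
  using assms unfolding PF_quantale_def pure_def le_perp_iff by blast

text \<open>The test by \<open>perp\<close> applies to compact elements, so compact factors are
  treated first; coherence keeps their product compact. General factors reduce to compact ones below
  them.\<close>

lemma m_prime_prime_part:
  fixes p :: "'a::comm_integral_quantale"
  assumes coh: "coherent TYPE('a)" and PF: "PF_quantale TYPE('a)" and p: "m_prime p"
  shows "m_prime (prime_part p)"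
proof -
  have alg: "algebraic TYPE('a)" and mK: "\<And>c d::'a. c \<in> K \<Longrightarrow> d \<in> K \<Longrightarrow> c * d \<in> K"
    using coh unfolding coherent_def by auto
  have compact_case: "c \<le> prime_part p \<or> d \<le> prime_part p"
    if c: "c \<in> K" and d: "d \<in> K" and "c * d \<le> prime_part p" for c d
  proof -
    have "\<not> perp (c * d) \<le> p" using that mK compact_le_prime_part_iff[OF p] by blast
    \<comment> \<open>A compact \<open>x\<close> makes \<open>d * x\<close> compact, so that the PF
      property applies to \<open>c\<close> and \<open>d * x\<close>.\<close>
    then obtain x where x: "x \<in> K" "x \<le> perp (c * d)" "\<not> x \<le> p"
      using algebraic_leI[OF alg] by blast
    then have "c * (d * x) = bot" by (simp add: le_perp_iff mult.assoc)
    then have 1: "sup (perp c) (perp (d * x)) = 1"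
      using PF_sup_perp[OF PF] c d x mK by blast
    have "\<not> perp c \<le> p \<or> \<not> perp d \<le> p"
    proof (rule ccontr)
      assume neg: "\<not> (\<not> perp c \<le> p \<or> \<not> perp d \<le> p)"
      \<comment> \<open>\<open>x * perp (d * x)\<close> is below \<open>perp d\<close>, hence below
        \<open>p\<close>; since \<open>x\<close> is not, primeness gives
        \<open>perp (d * x) \<le> p\<close>, and the join \<open>1\<close> falls below
        \<open>p\<close>.\<close>
      have "d * (x * perp (d * x)) = bot" by (simp only: mult.assoc[symmetric] mult_perp)
      then have "x * perp (d * x) \<le> p" using neg le_perp_iff order_trans by blast
      then have "perp (d * x) \<le> p" using m_prime_mult[OF p] x by blast
      then have "1 \<le> p" using neg by (simp add: 1[symmetric])
      then show False using p unfolding m_prime_def by auto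
    qed
    then show ?thesis using compact_le_prime_part_iff[OF p] c d by blast
  qed
  have "a \<le> prime_part p \<or> b \<le> prime_part p" if ab: "a * b \<le> prime_part p" for a b
  proof (rule ccontr)
    assume "\<not> (a \<le> prime_part p \<or> b \<le> prime_part p)"
    then obtain c d where cd: "c \<in> K" "c \<le> a" "\<not> c \<le> prime_part p"
      "d \<in> K" "d \<le> b" "\<not> d \<le> prime_part p"
      using algebraic_leI[OF alg, of a "prime_part p"] algebraic_leI[OF alg, of b "prime_part p"]
      by blast
    have "c * d \<le> a * b"
      using mult_mono_right[OF cd(5), of c] mult_mono_right[OF cd(2), of b]
      by (simp add: mult.commute)
    then show False using compact_case cd ab order_trans by blast
  qed
  moreover have "prime_part p < 1"
    using prime_part_le[OF p] p unfolding m_prime_def by (blast intro: le_less_trans)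
  ultimately show ?thesis unfolding m_prime_def by blast
qed

lemma pure_prime_part:
  fixes p :: "'a::comm_integral_quantale"
  assumes alg: "algebraic TYPE('a)" and PF: "PF_quantale TYPE('a)" and p: "m_prime p"
  shows "pure (prime_part p)"
  unfolding pure_def
proof (intro ballI impI)
  fix c :: 'a assume c: "c \<in> K" "c \<le> prime_part p"
  then have "\<not> perp c \<le> p" using compact_le_prime_part_iff[OF p] by blast
  then obtain x where x: "x \<in> K" "x \<le> perp c" "\<not> x \<le> p"
    using algebraic_leI[OF alg] by blast
  \<comment> \<open>Each compact \<open>y\<close> below \<open>perp x\<close> has
    \<open>x \<le> perp y\<close>, so \<open>perp y\<close> is not below \<open>p\<close>. Thus
    \<open>perp x\<close> can be replaced by \<open>prime_part p\<close> in the PF identity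
    \<open>sup (perp c) (perp x) = 1\<close>.\<close>
  have "perp x \<le> prime_part p"
  proof (rule algebraic_leI[OF alg])
    fix y assume y: "y \<in> K" "y \<le> perp x"
    then have "x \<le> perp y" by (simp add: le_perp_iff mult.commute)
    then show "y \<le> prime_part p"
      using compact_le_prime_part_iff[OF p] y x by (blast intro: order_trans)
  qed
  then have "sup (perp c) (perp x) \<le> sup (prime_part p) (perp c)" by (simp add: le_supI1)
  moreover have "sup (perp c) (perp x) = 1"
    using PF_sup_perp[OF PF c(1) x(1)] x(2) by (simp add: le_perp_iff)
  ultimately show "sup (prime_part p) (perp c) = 1" by (simp add: antisym le_one)
qed

lemma pure_le_m_prime:
  fixes a q :: "'a::comm_integral_quantale"
  assumes alg: "algebraic TYPE('a)" and a: "pure a" "a \<noteq> 1" and q: "m_prime q" "q \<le> a"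
  shows "a \<le> q"
proof (rule algebraic_leI[OF alg])
  fix c assume c: "c \<in> K" "c \<le> a"
  then have "sup a (perp c) = 1" using a(1) unfolding pure_def by blast
  then have "\<not> perp c \<le> q" using a(2) q(2) order_trans[of "perp c" q a] by (auto simp: sup.absorb1)
  then show "c \<le> q" using m_prime_mult[OF q(1), of c "perp c"] by (simp add: mult_perp)
qed

lemma pure_le_prime_part:
  fixes a p :: "'a::comm_integral_quantale"
  assumes alg: "algebraic TYPE('a)" and a: "pure a" and p: "m_prime p" "a \<le> p"
  shows "a \<le> prime_part p"
proof (rule algebraic_leI[OF alg])
  fix c assume c: "c \<in> K" "c \<le> a"
  then have "sup a (perp c) = 1" using a unfolding pure_def by blast
  \<comment> \<open>Otherwise \<open>a\<close> and \<open>perp c\<close> both lie below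
    \<open>p\<close>, forcing \<open>1 \<le> p\<close>.\<close>
  then have "\<not> perp c \<le> p" using p le_supI[of a p "perp c"] unfolding m_prime_def by auto
  then show "c \<le> prime_part p" using compact_le_prime_part_iff[OF p(1) c(1)] by blast
qed

theorem theorem6p12:
  assumes "coherent TYPE('a::comm_integral_quantale)"
    and "PF_quantale TYPE('a)"
  shows "(Min_primes :: 'a set) = Max_Vir"
proof (intro equalityI subsetI)
  have alg: "algebraic TYPE('a)" using assms(1) unfolding coherent_def by blast
  {
    fix p :: 'a assume "p \<in> Min_primes"
    then have p: "m_prime p" and min: "\<And>q. m_prime q \<Longrightarrow> q \<le> p \<Longrightarrow> q = p"
      unfolding Min_primes_def by auto
    have "prime_part p = p"
      using min m_prime_prime_part[OF assms p] prime_part_le[OF p] by blast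
    then have "pure p" using pure_prime_part[OF alg assms(2) p] by simp
    moreover have "p \<noteq> 1" using p unfolding m_prime_def by auto
    moreover have "q = p" if "pure q" "q \<noteq> 1" "p \<le> q" for q
      using pure_le_m_prime[OF alg that(1,2) p that(3)] that(3) by (rule antisym)
    ultimately show "p \<in> Max_Vir" unfolding Max_Vir_def Vir_def by auto
  next
    fix p :: 'a assume "p \<in> Max_Vir"
    then have p: "pure p" "p \<noteq> 1" and max: "\<And>q. pure q \<Longrightarrow> q \<noteq> 1 \<Longrightarrow> p \<le> q \<Longrightarrow> q = p"
      unfolding Max_Vir_def Vir_def by auto
    obtain m where m: "m_prime m" "p \<le> m"
      using ex_m_prime_above[of p] p(2) assms(1) unfolding coherent_def by blast
    have prime: "m_prime (prime_part m)" by (rule m_prime_prime_part[OF assms m(1)])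
    then have "prime_part m \<noteq> 1" unfolding m_prime_def by auto
    \<comment> \<open>Maximality of \<open>p\<close> applies, as \<open>prime_part m\<close> is
      pure, proper and above \<open>p\<close>.\<close>
    then have "prime_part m = p"
      using max pure_prime_part[OF alg assms(2) m(1)] pure_le_prime_part[OF alg p(1) m] by blast
    with prime have "m_prime p" by simp
    moreover have "q = p" if "m_prime q" "q \<le> p" for q
      using that(2) pure_le_m_prime[OF alg p that] by (rule antisym)
    ultimately show "p \<in> Min_primes" unfolding Min_primes_def by blast
  }
qed

end
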